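(* There is an algorithm that, given a proper interval graph $G=(V,E)$ and a positive integer $k$, decides in $O(|V|+|E|)$ time whether $G$ admits an equitable tree-$k$-coloring.
   Context: All graphs are finite, simple and undirected. An equitable tree-$k$-coloring of a graph $G$ is a map $c:V(G)\to\{1,\dots,k\}$ such that each $c^{-1}(i)$ induces a forest, and $\big||c^{-1}(i)|-|c^{-1}(j)|\big|\le 1$ for all $1\le i<j\le k$. A proper interval graph is a graph having an interval representation (a family of real intervals $T_v$, $v\in V(G)$, with $u,v$ adjacent iff $T_u\cap T_v\ne\emptyset$) in which no interval properly contains another. *)

theory Defs
  imports "HOL-Analysis.Analysis" "HOL-Library.FuncSet" "HOL-Library.Landau_Symbols"
begin

section \<open>Graphs\<close>

definition simple_graph :: "'a set \<Rightarrow> 'a set set \<Rightarrow> bool" where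
  "simple_graph V E \<longleftrightarrow> finite V \<and> (\<forall>e\<in>E. e \<subseteq> V \<and> card e = 2)"

definition induced_edges :: "'a set set \<Rightarrow> 'a set \<Rightarrow> 'a set set" where
  "induced_edges E S = {e \<in> E. e \<subseteq> S}"

definition graph_cycle :: "'a set set \<Rightarrow> 'a list \<Rightarrow> bool" where
  "graph_cycle E p \<longleftrightarrow> length p \<ge> 3 \<and> distinct p \<and>
     (\<forall>i < length p. {p ! i, p ! (Suc i mod length p)} \<in> E)"

definition forest :: "'a set \<Rightarrow> 'a set set \<Rightarrow> bool" where
  "forest V E \<longleftrightarrow> simple_graph V E \<and> \<not> (\<exists>p. set p \<subseteq> V \<and> graph_cycle E p)"

definition color_class :: "'a set \<Rightarrow> ('a \<Rightarrow> nat) \<Rightarrow> nat \<Rightarrow> 'a set" where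
  "color_class V c i = {v \<in> V. c v = i}"

definition equitable_tree_coloring ::
    "'a set \<Rightarrow> 'a set set \<Rightarrow> nat \<Rightarrow> ('a \<Rightarrow> nat) \<Rightarrow> bool" where
  "equitable_tree_coloring V E k c \<longleftrightarrow>
     c \<in> V \<rightarrow> {1..k} \<and>
     (\<forall>i\<in>{1..k}. forest (color_class V c i) (induced_edges E (color_class V c i))) \<and>
     (\<forall>i j. 1 \<le> i \<and> i < j \<and> j \<le> k \<longrightarrow>
        \<bar>int (card (color_class V c i)) - int (card (color_class V c j))\<bar> \<le> 1)"

text \<open>Intervals are nonempty; open, closed, half-open and unbounded ones are all allowed,
  and distinct vertices may have the same interval.\<close>

definition proper_interval_representation ::
    "'a set \<Rightarrow> 'a set set \<Rightarrow> ('a \<Rightarrow> real set) \<Rightarrow> bool" where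
  "proper_interval_representation V E T \<longleftrightarrow>
     (\<forall>v\<in>V. is_interval (T v) \<and> T v \<noteq> {}) \<and>
     (\<forall>u\<in>V. \<forall>v\<in>V. u \<noteq> v \<longrightarrow> ({u, v} \<in> E \<longleftrightarrow> T u \<inter> T v \<noteq> {})) \<and>
     (\<forall>u\<in>V. \<forall>v\<in>V. \<not> T u \<subset> T v)"

definition proper_interval_graph :: "'a set \<Rightarrow> 'a set set \<Rightarrow> bool" where
  "proper_interval_graph V E \<longleftrightarrow>
     simple_graph V E \<and> (\<exists>T. proper_interval_representation V E T)"

section \<open>Word RAM\<close>

text \<open>
  A random access machine with words of \<open>w\<close> bits: finitely many registers are named by a
  program, the memory is addressed by words, arithmetic is modulo \<open>2 ^ w\<close>, and every
  instruction costs one unit of time. Register operands are register numbers; for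
  \<open>Load d a\<close> and \<open>Store a s\<close> the address is the content of register \<open>a\<close>.
\<close>

datatype instr =
    Const nat nat
  | Move nat nat
  | Add nat nat nat
  | Sub nat nat nat
  | Load nat nat
  | Store nat nat
  | Jump nat
  | Jump_less nat nat nat
  | Jump_eq nat nat nat

record config =
  pc :: nat
  reg :: "nat \<Rightarrow> nat"
  mem :: "nat \<Rightarrow> nat"

definition set_reg :: "nat \<Rightarrow> nat \<Rightarrow> config \<Rightarrow> config" where
  "set_reg d x s = s\<lparr>reg := (reg s)(d := x), pc := Suc (pc s)\<rparr>"

definition jump_if :: "bool \<Rightarrow> nat \<Rightarrow> config \<Rightarrow> config" where
  "jump_if b l s = s\<lparr>pc := (if b then l else Suc (pc s))\<rparr>"

fun exec :: "nat \<Rightarrow> instr \<Rightarrow> config \<Rightarrow> config" where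
  "exec w (Const d x) s = set_reg d (x mod 2 ^ w) s"
| "exec w (Move d a) s = set_reg d (reg s a) s"
| "exec w (Add d a b) s = set_reg d ((reg s a + reg s b) mod 2 ^ w) s"
| "exec w (Sub d a b) s = set_reg d ((reg s a + 2 ^ w - reg s b) mod 2 ^ w) s"
| "exec w (Load d a) s = set_reg d (mem s (reg s a)) s"
| "exec w (Store a r) s = s\<lparr>mem := (mem s)(reg s a := reg s r), pc := Suc (pc s)\<rparr>"
| "exec w (Jump l) s = jump_if True l s"
| "exec w (Jump_less a b l) s = jump_if (reg s a < reg s b) l s"
| "exec w (Jump_eq a b l) s = jump_if (reg s a = reg s b) l s"

text \<open>The machine halts, and then stays put, once the program counter leaves the program.\<close>

definition halted :: "instr list \<Rightarrow> config \<Rightarrow> bool" where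
  "halted P s \<longleftrightarrow> length P \<le> pc s"

definition step :: "nat \<Rightarrow> instr list \<Rightarrow> config \<Rightarrow> config" where
  "step w P s = (if halted P s then s else exec w (P ! pc s) s)"

definition init_config :: "nat list \<Rightarrow> config" where
  "init_config xs =
     \<lparr>pc = 0, reg = (\<lambda>_. 0), mem = (\<lambda>i. if i < length xs then xs ! i else 0)\<rparr>"

definition answers_within :: "nat \<Rightarrow> instr list \<Rightarrow> nat list \<Rightarrow> nat \<Rightarrow> bool \<Rightarrow> bool" where
  "answers_within w P xs t b \<longleftrightarrow>
     (\<exists>i\<le>t. let s = (step w P ^^ i) (init_config xs)
            in halted P s \<and> reg s 0 = (if b then 1 else 0))"

text \<open>The largest number that a machine needs in order to read and address its input.\<close>

definition input_bound :: "nat list \<Rightarrow> nat" where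
  "input_bound xs = Max (insert (length xs) (set xs))"

text \<open>As usual, the word length is only required to be at least a constant times the logarithm
  of the input bound; the argument 2 of \<open>max\<close> keeps that logarithm positive.\<close>

definition sufficient_word_length :: "nat \<Rightarrow> nat list \<Rightarrow> nat \<Rightarrow> bool" where
  "sufficient_word_length c xs w \<longleftrightarrow> real w \<ge> real c * log 2 (real (max 2 (input_bound xs)))"

section \<open>Input as adjacency lists\<close>

text \<open>The list \<open>vs\<close> numbers the vertices \<open>0, \<dots>, n - 1\<close>; the neighbours of each vertex are
  listed by number, once each, in arbitrary order.\<close>

definition adjacency_lists ::
    "'a set \<Rightarrow> 'a set set \<Rightarrow> 'a list \<Rightarrow> nat list list \<Rightarrow> bool" where
  "adjacency_lists V E vs adj \<longleftrightarrow>
     distinct vs \<and> set vs = V \<and> length adj = length vs \<and>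
     (\<forall>i < length vs. distinct (adj ! i) \<and>
        set (adj ! i) = {j. j < length vs \<and> {vs ! i, vs ! j} \<in> E})"

text \<open>Memory layout: \<open>n\<close>, \<open>k\<close>, then \<open>n + 1\<close> addresses, then the concatenated adjacency lists.
  The list of vertex \<open>i\<close> occupies the cells from the \<open>i\<close>-th address (inclusive) to the next
  one (exclusive); the lists start at cell \<open>n + 3\<close>.\<close>

definition encode_instance :: "nat list list \<Rightarrow> nat \<Rightarrow> nat list" where
  "encode_instance adj k =
     [length adj, k]
     @ map (\<lambda>i. length adj + 3 + length (concat (take i adj))) [0..<Suc (length adj)]
     @ concat adj"

end

(* Ordering the vertices of a proper interval graph by the right ends of their intervals and
   coloring them cyclically, two vertices of a color that have another one in between are at
   least 2k positions apart, so they can only be adjacent if there is a clique with 2k + 1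
   vertices. Conversely a color class meets every clique in at most two vertices. Hence a coloring
   exists iff every clique has at most 2k vertices. As each nonempty induced subgraph has a
   simplicial vertex, this in turn holds iff the 2k-core of the graph is empty, which is decided
   by repeatedly deleting vertices of degree less than 2k. *)
theory Submission
  imports Defs
begin

section \<open>Colorings and cliques\<close>

text \<open>The algorithm sees adjacency lists only. An interval representation is never computed:
  it serves to prove that clique sizes decide the question, while the machine works with degrees
  alone. Cliques and degrees are linked in both directions: in a nonempty set of minimum degree at
  least 2k, a simplicial vertex together with its neighbours is a clique on at least 2k + 1
  vertices, and a clique on more than 2k vertices is itself a set of minimum degree at least 2k.
  Equitability costs nothing, because the color classes of the cyclic coloring are residue classes
  of positions. Ends of intervals may be open or infinite, so right ends are compared by a preorder
  on sets instead of by real numbers. Linear time comes from a queue of deleted vertices: a vertex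
  enters it at most once, so every adjacency list is read at most once and each of its entries costs
  one decrement of a degree counter.\<close>

definition clique :: "'a set set \<Rightarrow> 'a set \<Rightarrow> bool" where
  "clique E K \<longleftrightarrow> (\<forall>u\<in>K. \<forall>v\<in>K. u \<noteq> v \<longrightarrow> {u, v} \<in> E)"

text \<open>Compares right ends without suprema: an open end counts as smaller than a closed one at
  the same point, and unbounded intervals need no special case.\<close>

definition right_le :: "real set \<Rightarrow> real set \<Rightarrow> bool" where
  "right_le A B \<longleftrightarrow> (\<forall>x\<in>A. \<exists>y\<in>B. x \<le> y)"

lemma right_le_refl: "right_le A A"
  unfolding right_le_def by blast

lemma right_le_trans: "right_le A B \<Longrightarrow> right_le B C \<Longrightarrow> right_le A C"
  unfolding right_le_def by (meson order_trans)

lemma right_le_total: "right_le A B \<or> right_le B A"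
  unfolding right_le_def by (meson linear)

text \<open>The rank of \<open>u\<close> is the number of vertices whose interval ends no later than
  \<open>T u\<close>. It turns the total preorder into a numerical key, usable for sorting and for
  choosing a least vertex.\<close>

lemma ex_right_le_rank:
  assumes "finite V"
  obtains f :: "'a \<Rightarrow> nat"
  where "\<And>u v. u \<in> V \<Longrightarrow> v \<in> V \<Longrightarrow> f u \<le> f v \<Longrightarrow> right_le (T u) (T v)"
proof
  fix u v
  assume uv: "u \<in> V" "v \<in> V"
    and le: "card {x \<in> V. right_le (T x) (T u)} \<le> card {x \<in> V. right_le (T x) (T v)}"
  show "right_le (T u) (T v)"
  proof (rule ccontr)
    assume no: "\<not> right_le (T u) (T v)"
    then have "right_le (T v) (T u)"
      using right_le_total by blast
    then have "{x \<in> V. right_le (T x) (T v)} \<subset> {x \<in> V. right_le (T x) (T u)}"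
      using uv no right_le_trans right_le_refl by blast
    then have "card {x \<in> V. right_le (T x) (T v)} < card {x \<in> V. right_le (T x) (T u)}"
      by (rule psubset_card_mono[rotated]) (simp add: assms)
    then show False
      using le by simp
  qed
qed

lemma is_interval_betweenD:
  fixes A :: "real set"
  assumes "is_interval A" "x \<in> A" "z \<in> A" "x \<le> y" "y \<le> z"
  shows "y \<in> A"
  using assms unfolding is_interval_1 by blast

text \<open>A vertex whose interval ends first is simplicial.\<close>

lemma ex_simplicial:
  assumes T: "proper_interval_representation V E T"
    and "finite V" "U \<subseteq> V" "U \<noteq> {}"
  obtains v where "v \<in> U" "clique E (insert v {u \<in> U. u \<noteq> v \<and> {v, u} \<in> E})"
proof -
  obtain f :: "'a \<Rightarrow> nat"
    where f: "\<And>u v. u \<in> V \<Longrightarrow> v \<in> V \<Longrightarrow> f u \<le> f v \<Longrightarrow> right_le (T u) (T v)"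
    using ex_right_le_rank[OF \<open>finite V\<close>] by metis
  obtain v where v: "v \<in> U" "\<And>u. u \<in> U \<Longrightarrow> f v \<le> f u"
    using \<open>U \<noteq> {}\<close> ex_has_least_nat[of "\<lambda>v. v \<in> U" _ f] by blast
  \<comment> \<open>Of two points where neighbours of \<open>v\<close> touch \<open>T v\<close>, the
    later one, \<open>y\<close>, lies in both neighbours: \<open>T a\<close> contains
    \<open>x\<close> and, ending no earlier than \<open>T v\<close>, also a point beyond
    \<open>y\<close>.\<close>
  have meet: "T a \<inter> T b \<noteq> {}"
    if x: "x \<in> T a" "x \<in> T v" and y: "y \<in> T b" "y \<in> T v" and ab: "a \<in> U" "b \<in> U" and "x \<le> y"
    for a b x y
  proof -
    have "right_le (T v) (T a)"
      using f v ab \<open>U \<subseteq> V\<close> by blast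
    then obtain z where "z \<in> T a" "y \<le> z"
      using y unfolding right_le_def by blast
    moreover have "is_interval (T a)"
      using T ab \<open>U \<subseteq> V\<close> unfolding proper_interval_representation_def by blast
    ultimately have "y \<in> T a"
      using is_interval_betweenD[of "T a" x z y] x \<open>x \<le> y\<close> by blast
    then show ?thesis
      using y by blast
  qed
  have adj: "{a, b} \<in> E \<longleftrightarrow> T a \<inter> T b \<noteq> {}" if "a \<in> U" "b \<in> U" "a \<noteq> b" for a b
    using T that \<open>U \<subseteq> V\<close> unfolding proper_interval_representation_def by blast
  have both: "{a, b} \<in> E"
    if a: "a \<in> U" "a \<noteq> v" "{v, a} \<in> E" and b: "b \<in> U" "b \<noteq> v" "{v, b} \<in> E" and "a \<noteq> b" for a b
  proof -
    obtain x where x: "x \<in> T a" "x \<in> T v"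
      using adj[of v a] a v by blast
    obtain y where y: "y \<in> T b" "y \<in> T v"
      using adj[of v b] b v by blast
    have "T a \<inter> T b \<noteq> {}"
      using meet[OF x y a(1) b(1)] meet[OF y x b(1) a(1)] by (metis inf_commute linear)
    then show ?thesis
      using adj a b \<open>a \<noteq> b\<close> by blast
  qed
  have "clique E (insert v {u \<in> U. u \<noteq> v \<and> {v, u} \<in> E})"
    unfolding clique_def
  proof (intro ballI impI)
    fix a b
    assume "a \<in> insert v {u \<in> U. u \<noteq> v \<and> {v, u} \<in> E}" "b \<in> insert v {u \<in> U. u \<noteq> v \<and> {v, u} \<in> E}"
      "a \<noteq> b"
    then show "{a, b} \<in> E"
      using both[of a b] insert_commute[of a v "{}"] by (cases "a = v"; cases "b = v") simp_all
  qed
  with v(1) show thesis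
    by (rule that)
qed

text \<open>Properness enters here. If \<open>T b\<close> missed \<open>x\<close>, convexity would
  place it entirely to the right of \<open>x\<close>; as it ends no later than \<open>T c\<close>,
  it would be a proper subset of \<open>T c\<close>.\<close>

lemma right_le_between:
  assumes T: "proper_interval_representation V E T"
    and "a \<in> V" "b \<in> V" "c \<in> V"
    and ab: "right_le (T a) (T b)" and bc: "right_le (T b) (T c)"
    and x: "x \<in> T a" "x \<in> T c"
  shows "x \<in> T b"
proof (rule ccontr)
  assume no: "x \<notin> T b"
  have iv: "is_interval (T b)" "is_interval (T c)" and proper: "\<not> T b \<subset> T c"
    using T \<open>b \<in> V\<close> \<open>c \<in> V\<close> unfolding proper_interval_representation_def by blast+
  obtain y where y: "y \<in> T b" "x \<le> y"
    using ab x unfolding right_le_def by blast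
  have "z \<in> T c" if z: "z \<in> T b" for z
  proof -
    have "x \<le> z"
      using is_interval_betweenD[OF iv(1) z y(1)] y no by (meson linear)
    moreover obtain z' where "z' \<in> T c" "z \<le> z'"
      using bc z unfolding right_le_def by blast
    ultimately show ?thesis
      using is_interval_betweenD[OF iv(2)] x by blast
  qed
  then show False
    using proper no x by blast
qed

lemma ex_umbrella_ordering:
  assumes T: "proper_interval_representation V E T" and fin: "finite V"
  obtains ws where "distinct ws" "set ws = V"
    "\<And>i j l. i < j \<Longrightarrow> j < l \<Longrightarrow> l < length ws \<Longrightarrow> {ws ! i, ws ! l} \<in> E
       \<Longrightarrow> {ws ! i, ws ! j} \<in> E \<and> {ws ! j, ws ! l} \<in> E"
proof -
  obtain f :: "'a \<Rightarrow> nat"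
    where f: "\<And>u v. u \<in> V \<Longrightarrow> v \<in> V \<Longrightarrow> f u \<le> f v \<Longrightarrow> right_le (T u) (T v)"
    using ex_right_le_rank[OF fin] by metis
  obtain us where us: "distinct us" "set us = V"
    using fin finite_distinct_list by blast
  define ws where "ws = sort_key f us"
  have ws: "distinct ws" "set ws = V" "sorted (map f ws)"
    using us by (simp_all add: ws_def)
  have le: "right_le (T (ws ! i)) (T (ws ! j))" if "i \<le> j" "j < length ws" for i j
  proof (rule f)
    show "f (ws ! i) \<le> f (ws ! j)"
      using sorted_nth_mono[OF ws(3), of i j] that by simp
  qed (use ws(2) that in auto)
  have adj: "{ws ! i, ws ! j} \<in> E \<longleftrightarrow> T (ws ! i) \<inter> T (ws ! j) \<noteq> {}"
    if "i < j" "j < length ws" for i j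
  proof -
    have "ws ! i \<in> V" "ws ! j \<in> V" "ws ! i \<noteq> ws ! j"
      using that ws nth_eq_iff_index_eq[OF ws(1), of i j] nth_mem[of i ws] nth_mem[of j ws] by auto
    then show ?thesis
      using T unfolding proper_interval_representation_def by blast
  qed
  show thesis
  proof (rule that[OF ws(1,2)])
    fix i j l
    assume ijl: "i < j" "j < l" "l < length ws" and E: "{ws ! i, ws ! l} \<in> E"
    then have V: "ws ! i \<in> V" "ws ! j \<in> V" "ws ! l \<in> V"
      using ws(2) nth_mem[of _ ws] by auto
    obtain x where x: "x \<in> T (ws ! i)" "x \<in> T (ws ! l)"
      using E adj[of i l] ijl by auto
    have "x \<in> T (ws ! j)"
      using right_le_between[OF T V le le x] ijl by simp
    then show "{ws ! i, ws ! j} \<in> E \<and> {ws ! j, ws ! l} \<in> E"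
      using adj[of i j] adj[of j l] x ijl by auto
  qed
qed

section \<open>The cyclic coloring\<close>

lemma card_residue_class:
  fixes n k r :: nat
  assumes "r < k"
  shows "card {i. i < n \<and> i mod k = r} = (n + k - 1 - r) div k"
proof -
  \<comment> \<open>The quotient is (n - r) / k rounded up. Since \<open>r < k\<close>, the
    subtraction in \<open>n + k - 1 - r\<close> never truncates, even for
    \<open>n < r\<close>.\<close>
  have less: "q * k + r < n \<longleftrightarrow> q < (n + k - 1 - r) div k" for q
  proof -
    have "q < (n + k - 1 - r) div k \<longleftrightarrow> Suc q * k \<le> n + k - 1 - r"
      using assms by (simp add: less_eq_div_iff_mult_less_eq flip: Suc_le_eq)
    then show ?thesis
      using assms by auto
  qed
  have "{i. i < n \<and> i mod k = r} = (\<lambda>q. q * k + r) ` {..<(n + k - 1 - r) div k}"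
  proof (intro equalityI subsetI)
    fix i
    assume "i \<in> {i. i < n \<and> i mod k = r}"
    then have "i = i div k * k + r" "i < n"
      using div_mult_mod_eq[of i k] by auto
    then show "i \<in> (\<lambda>q. q * k + r) ` {..<(n + k - 1 - r) div k}"
      using less[of "i div k"] by (metis imageI lessThan_iff)
  next
    fix i
    assume "i \<in> (\<lambda>q. q * k + r) ` {..<(n + k - 1 - r) div k}"
    then obtain q where "i = q * k + r" "i < n"
      using less by blast
    then show "i \<in> {i. i < n \<and> i mod k = r}"
      using assms by simp
  qed
  moreover have "inj_on (\<lambda>q. q * k + r) A" for A
    using assms by (auto intro: inj_onI)
  ultimately show ?thesis
    by (simp add: card_image)
qed

text \<open>The numerators of the two cardinalities differ by \<open>s - r < k\<close>, so their
  quotients by \<open>k\<close> differ by at most one.\<close>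

lemma residue_classes_balanced:
  fixes n k r s :: nat
  assumes "r < s" "s < k"
  shows "\<bar>int (card {i. i < n \<and> i mod k = r}) - int (card {i. i < n \<and> i mod k = s})\<bar> \<le> 1"
proof -
  have "(n + k - 1 - s) div k \<le> (n + k - 1 - r) div k"
    using assms by (intro div_le_mono) auto
  moreover have "(n + k - 1 - r) div k \<le> (n + k - 1 - s + k) div k"
    using assms by (intro div_le_mono) auto
  moreover have "(n + k - 1 - s + k) div k = (n + k - 1 - s) div k + 1"
    by (rule div_add_self2) (use assms in simp)
  ultimately show ?thesis
    using assms by (simp add: card_residue_class)
qed

text \<open>The cyclic successor and predecessor; they differ because a cycle has at least three
  vertices. Applied to the vertex of least position, this yields two distinct neighbours that both
  come later.\<close>

lemma graph_cycle_neighbours: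
  assumes "graph_cycle E p" "x \<in> set p"
  obtains y z where "y \<in> set p" "z \<in> set p" "y \<noteq> x" "z \<noteq> x" "y \<noteq> z" "{x, y} \<in> E" "{x, z} \<in> E"
proof -
  have p: "length p \<ge> 3" "distinct p"
    and E: "\<And>i. i < length p \<Longrightarrow> {p ! i, p ! (Suc i mod length p)} \<in> E"
    using assms unfolding graph_cycle_def by blast+
  obtain i where i: "i < length p" "x = p ! i"
    using assms by (auto simp: in_set_conv_nth)
  define a where "a = Suc i mod length p"
  define b where "b = (if i = 0 then length p - 1 else i - 1)"
  have ab: "a < length p" "b < length p" "Suc b mod length p = i" "a \<noteq> i" "b \<noteq> i" "a \<noteq> b"
    using p i by (auto simp: a_def b_def mod_Suc)
  show thesis
  proof (rule that)
    show "{x, p ! a} \<in> E" "{x, p ! b} \<in> E"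
      using E[of i] E[of b] i ab by (auto simp: a_def insert_commute)
  qed (use ab i p in \<open>auto simp: nth_eq_iff_index_eq\<close>)
qed

lemma equitable_tree_coloring_if_cliques_le:
  assumes G: "proper_interval_graph V E" and k: "k > 0"
    and small: "\<And>K. K \<subseteq> V \<Longrightarrow> clique E K \<Longrightarrow> card K \<le> 2 * k"
  shows "\<exists>col. equitable_tree_coloring V E k col"
proof -
  obtain T where T: "proper_interval_representation V E T" and simple: "simple_graph V E"
    using G unfolding proper_interval_graph_def by blast
  then have fin: "finite V"
    unfolding simple_graph_def by blast
  obtain ws where ws: "distinct ws" "set ws = V"
    and umb: "\<And>i j l. i < j \<Longrightarrow> j < l \<Longrightarrow> l < length ws \<Longrightarrow> {ws ! i, ws ! l} \<in> E
       \<Longrightarrow> {ws ! i, ws ! j} \<in> E \<and> {ws ! j, ws ! l} \<in> E"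
    using ex_umbrella_ordering[OF T fin] by metis
  define pos where "pos = the_inv_into {..<length ws} (\<lambda>i. ws ! i)"
  have inj: "inj_on (\<lambda>i. ws ! i) {..<length ws}"
    using ws by (simp add: inj_on_nth)
  have pos_nth: "pos (ws ! i) = i" if "i < length ws" for i
    using the_inv_into_f_f[OF inj, of i] that by (simp add: pos_def)
  have nth_pos: "ws ! pos v = v" and pos_less: "pos v < length ws" if "v \<in> V" for v
    using that ws pos_nth by (metis in_set_conv_nth)+
  define col where "col v = Suc (pos v mod k)" for v
  have cls: "color_class V col i = (\<lambda>j. ws ! j) ` {j. j < length ws \<and> j mod k = i - 1}" if "i \<ge> 1" for i
    using that ws nth_pos pos_less pos_nth unfolding color_class_def col_def
    by (auto simp: image_iff in_set_conv_nth) (metis diff_Suc_1)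
  have card_cls: "card (color_class V col i) = card {j. j < length ws \<and> j mod k = i - 1}" if "i \<ge> 1" for i
    unfolding cls[OF that] by (rule card_image) (rule inj_on_subset[OF inj], auto)
  \<comment> \<open>Two uses of the umbrella property, first with left end \<open>x\<close> and then
    with right end \<open>b\<close>, make all positions from \<open>x\<close> to \<open>z\<close>
    pairwise adjacent: a clique of at least 2k + 1 vertices.\<close>
  have clq: False
    if E: "{ws ! x, ws ! z} \<in> E" and x: "x + 2 * k \<le> z" and z: "z < length ws" for x z
  proof -
    have to: "{ws ! x, ws ! b} \<in> E" if "x < b" "b \<le> z" for b
      using umb[of x b z] E z that by (cases "b = z") auto
    have "{ws ! a, ws ! b} \<in> E" if "x \<le> a" "a < b" "b \<le> z" for a b
      using umb[of x a b] to[of b] z that by (cases "a = x") auto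
    then have "clique E ((\<lambda>j. ws ! j) ` {x..z})"
      unfolding clique_def by (auto simp: insert_commute) (metis insert_commute nat_neq_iff)
    moreover have "(\<lambda>j. ws ! j) ` {x..z} \<subseteq> V"
      using ws(2) z by auto
    moreover have "card ((\<lambda>j. ws ! j) ` {x..z}) = Suc z - x"
      using z by (subst card_image) (auto intro: inj_on_subset[OF inj])
    ultimately show False
      using small[of "(\<lambda>j. ws ! j) ` {x..z}"] x by simp
  qed
  have gap: "a + k \<le> b" if "a < b" "a mod k = b mod k" for a b :: nat
  proof -
    have "k dvd b - a"
      using that mod_eq_dvd_iff_nat[of a b k] by simp
    then show ?thesis
      using that by (auto dest: dvd_imp_le)
  qed
  have acyclic: "\<not> graph_cycle (induced_edges E (color_class V col i)) p"
    if p: "set p \<subseteq> color_class V col i" for i p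
  proof
    assume cyc: "graph_cycle (induced_edges E (color_class V col i)) p"
    then have "p ! 0 \<in> set p"
      unfolding graph_cycle_def by (intro nth_mem) linarith
    \<comment> \<open>At the vertex of least position both neighbours on the cycle lie later in the
      same residue class modulo \<open>k\<close>, so the farther one is at least 2k positions
      ahead.\<close>
    then obtain x where x: "x \<in> set p" "\<And>y. y \<in> set p \<Longrightarrow> pos x \<le> pos y"
      using ex_has_least_nat[of "\<lambda>v. v \<in> set p" "p ! 0" pos] by blast
    obtain y z where yz: "y \<in> set p" "z \<in> set p" "y \<noteq> x" "z \<noteq> x" "y \<noteq> z"
      and "{x, y} \<in> induced_edges E (color_class V col i)" "{x, z} \<in> induced_edges E (color_class V col i)"
      by (rule graph_cycle_neighbours[OF cyc x(1)])
    then have edges: "{x, y} \<in> E" "{x, z} \<in> E"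
      unfolding induced_edges_def by simp_all
    have V: "x \<in> V" "y \<in> V" "z \<in> V" and same: "pos x mod k = pos y mod k" "pos y mod k = pos z mod k"
      using p x yz unfolding color_class_def col_def by auto
    have ne: "pos y \<noteq> pos x" "pos z \<noteq> pos x" "pos y \<noteq> pos z"
      using nth_pos V yz by metis+
    have lt: "pos x < pos y" "pos x < pos z"
      using x(2)[of y] x(2)[of z] yz ne by auto
    show False
    proof (cases "pos y < pos z")
      case True
      then have "pos x + 2 * k \<le> pos z"
        using gap[of "pos x" "pos y"] gap[of "pos y" "pos z"] lt same by simp
      then show False
        using clq[of "pos x" "pos z"] V edges nth_pos pos_less by simp
    next
      case False
      then have "pos x + 2 * k \<le> pos y"
        using gap[of "pos x" "pos z"] gap[of "pos z" "pos y"] lt same ne by simp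
      then show False
        using clq[of "pos x" "pos y"] V edges nth_pos pos_less by simp
    qed
  qed
  have "equitable_tree_coloring V E k col"
    unfolding equitable_tree_coloring_def
  proof (intro conjI ballI allI impI)
    show "col \<in> V \<rightarrow> {1..k}"
      using k by (auto simp: col_def Suc_le_eq)
  next
    fix i
    assume "i \<in> {1..k}"
    show "forest (color_class V col i) (induced_edges E (color_class V col i))"
      using acyclic simple fin
      unfolding forest_def simple_graph_def induced_edges_def color_class_def by auto
  next
    fix i j
    assume "1 \<le> i \<and> i < j \<and> j \<le> k"
    then have "i - 1 < j - 1" "j - 1 < k" "1 \<le> i" "1 \<le> j"
      by auto
    then show "\<bar>int (card (color_class V col i)) - int (card (color_class V col j))\<bar> \<le> 1"
      unfolding card_cls[OF \<open>1 \<le> i\<close>] card_cls[OF \<open>1 \<le> j\<close>] by (intro residue_classes_balanced)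
  qed
  then show ?thesis
    by blast
qed

text \<open>Three vertices of a clique in one color class would form a triangle there, so each of
  the \<open>k\<close> classes contributes at most two.\<close>

lemma clique_le_if_equitable_tree_coloring:
  assumes col: "equitable_tree_coloring V E k col" and "finite V" and K: "K \<subseteq> V" "clique E K"
  shows "card K \<le> 2 * k"
proof -
  have finK: "finite K"
    using assms finite_subset by blast
  have two: "card (K \<inter> color_class V col i) \<le> 2" if i: "i \<in> {1..k}" for i
  proof (rule ccontr)
    assume "\<not> ?thesis"
    then have "3 \<le> card (K \<inter> color_class V col i)"
      by simp
    then obtain D where D: "D \<subseteq> K \<inter> color_class V col i" "card D = 3"
      using obtain_subset_with_card_n by metis
    then obtain a b c where abc: "D = {a, b, c}" "a \<noteq> b" "b \<noteq> c" "a \<noteq> c"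
      by (auto simp: card_3_iff)
    have in_clique: "x \<in> K" "x \<in> color_class V col i" if "x \<in> {a, b, c}" for x
      using D that abc(1) by blast+
    have "{x, y} \<in> induced_edges E (color_class V col i)" if "x \<in> {a, b, c}" "y \<in> {a, b, c}" "x \<noteq> y" for x y
      using in_clique that K(2) unfolding induced_edges_def clique_def by simp
    from this[of a b] this[of b c] this[of c a]
    have "graph_cycle (induced_edges E (color_class V col i)) [a, b, c]"
      using abc unfolding graph_cycle_def by (simp add: All_less_Suc)
    moreover have "set [a, b, c] \<subseteq> color_class V col i"
      using in_clique by auto
    moreover have "forest (color_class V col i) (induced_edges E (color_class V col i))"
      using col i unfolding equitable_tree_coloring_def by blast
    ultimately show False
      unfolding forest_def by blast
  qed
  have "K = (\<Union>i\<in>{1..k}. K \<inter> color_class V col i)"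
    using K col unfolding equitable_tree_coloring_def color_class_def by auto
  then have "card K \<le> (\<Sum>i\<in>{1..k}. card (K \<inter> color_class V col i))"
    using card_UN_le[of "{1..k}" "\<lambda>i. K \<inter> color_class V col i"] by simp
  also have "\<dots> \<le> (\<Sum>i\<in>{1..k}. 2)"
    by (rule sum_mono) (rule two)
  finally show ?thesis
    by simp
qed

section \<open>Peeling\<close>

text \<open>Any set of minimum degree at least \<open>t\<close> in its induced subgraph, not only
  the largest. The \<open>t\<close>-core of the graph is the union of these sets, so it is empty iff
  \<open>{}\<close> is the only one.\<close>

definition core :: "nat list list \<Rightarrow> nat \<Rightarrow> nat set \<Rightarrow> bool" where
  "core adj t W \<longleftrightarrow> W \<subseteq> {..<length adj} \<and> (\<forall>u\<in>W. t \<le> card (set (adj ! u) \<inter> W))"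

definition symmetric_lists :: "nat list list \<Rightarrow> bool" where
  "symmetric_lists adj \<longleftrightarrow>
     (\<forall>u<length adj. distinct (adj ! u) \<and> set (adj ! u) \<subseteq> {..<length adj} \<and>
        (\<forall>v<length adj. v \<in> set (adj ! u) \<longrightarrow> u \<in> set (adj ! v)))"

text \<open>The queue \<open>q\<close> holds the vertices known to lie outside every core. The lists of its first
  \<open>h\<close> entries have been fetched: \<open>S\<close> has been scanned and \<open>R\<close> is still pending.
  The counters \<open>d\<close> are the degrees minus the number of scanned occurrences.\<close>

definition peeling ::
    "nat list list \<Rightarrow> nat \<Rightarrow> nat list \<Rightarrow> nat \<Rightarrow> nat list \<Rightarrow> nat list \<Rightarrow> (nat \<Rightarrow> nat) \<Rightarrow> bool" where
  "peeling adj t q h S R d \<longleftrightarrow>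
     distinct q \<and> set q \<subseteq> {..<length adj} \<and> h \<le> length q \<and>
     S @ R = concat (map ((!) adj) (take h q)) \<and>
     (\<forall>u<length adj. d u + count_list S u = length (adj ! u)) \<and>
     (\<forall>u<length adj. u \<in> set q \<longleftrightarrow> d u < t) \<and>
     (\<forall>W. core adj t W \<longrightarrow> W \<inter> set q = {})"

lemma count_list_distinct: "distinct xs \<Longrightarrow> count_list xs u = (if u \<in> set xs then 1 else 0)"
  by (induction xs) auto

text \<open>By symmetry \<open>u\<close> occurs in the list of \<open>v\<close>, and then exactly
  once, iff \<open>v\<close> is a neighbour of \<open>u\<close>. Occurrences in scanned lists thus
  count deleted neighbours.\<close>

lemma count_list_concat_lists:
  assumes "symmetric_lists adj" "distinct q" "set q \<subseteq> {..<length adj}" "u < length adj"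
  shows "count_list (concat (map ((!) adj) q)) u = card (set (adj ! u) \<inter> set q)"
  using assms(2,3)
proof (induction q)
  case (Cons v q)
  have "count_list (adj ! v) u = (if v \<in> set (adj ! u) then 1 else 0)"
    using Cons.prems assms(1,4) unfolding symmetric_lists_def
    by (subst count_list_distinct) auto
  with Cons show ?case
    by (auto simp: Int_insert_right)
qed simp

lemma peeling_init:
  "peeling adj t (filter (\<lambda>u. length (adj ! u) < t) [0..<length adj]) 0 [] [] (\<lambda>u. length (adj ! u))"
proof -
  have "W \<inter> {u. u < length adj \<and> length (adj ! u) < t} = {}" if "core adj t W" for W
  proof -
    have "t \<le> length (adj ! u)" if "u \<in> W" for u
    proof -
      have "t \<le> card (set (adj ! u) \<inter> W)"
        using that \<open>core adj t W\<close> unfolding core_def by blast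
      also have "\<dots> \<le> card (set (adj ! u))"
        by (intro card_mono) auto
      finally show ?thesis
        using card_length[of "adj ! u"] by linarith
    qed
    then show ?thesis
      by fastforce
  qed
  then show ?thesis
    unfolding peeling_def by auto
qed

lemma peeling_fetch:
  assumes "peeling adj t q h S [] d" "h < length q"
  shows "peeling adj t q (Suc h) S (adj ! (q ! h)) d"
  using assms unfolding peeling_def by (auto simp: take_Suc_conv_app_nth)

text \<open>The test \<open>d u = t\<close> is made before the decrement, so it catches exactly the
  moment when the counter drops below \<open>t\<close>. This enqueues \<open>u\<close> once, without
  any separate mark for queued vertices.\<close>

lemma peeling_scan:
  assumes sym: "symmetric_lists adj" and inv: "peeling adj t q h S (u # R) d"
  shows "u < length adj" "0 < d u"
    "peeling adj t (if d u = t then q @ [u] else q) h (S @ [u]) R (d(u := d u - 1))"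
proof -
  have q: "distinct q" "set q \<subseteq> {..<length adj}" "h \<le> length q"
    and S: "S @ u # R = concat (map ((!) adj) (take h q))"
    and d: "\<And>v. v < length adj \<Longrightarrow> d v + count_list S v = length (adj ! v)"
    and less: "\<And>v. v < length adj \<Longrightarrow> v \<in> set q \<longleftrightarrow> d v < t"
    and cores: "\<And>W. core adj t W \<Longrightarrow> W \<inter> set q = {}"
    using inv unfolding peeling_def by blast+
  have qh: "set (take h q) \<subseteq> set q"
    by (rule set_take_subset)
  have "u \<in> set (concat (map ((!) adj) (take h q)))"
    unfolding S[symmetric] by simp
  then obtain v where "v \<in> set q" "u \<in> set (adj ! v)"
    using qh by auto
  then show u: "u < length adj"
    using sym q(2) unfolding symmetric_lists_def by blast
  \<comment> \<open>The occurrence of \<open>u\<close> just being read is still missing from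
    \<open>S\<close>; it accounts for the \<open>Suc\<close> in the next bound, on which both
    \<open>0 < d u\<close> and the exclusion of \<open>u\<close> from all cores depend.\<close>
  have "count_list (S @ u # R) u = card (set (adj ! u) \<inter> set (take h q))"
    unfolding S using count_list_concat_lists[OF sym _ _ u, of "take h q"] q qh by auto
  then have scanned: "Suc (count_list S u) \<le> card (set (adj ! u) \<inter> set (take h q))"
    by simp
  also have "\<dots> \<le> card (set (adj ! u) \<inter> set q)"
    using qh by (intro card_mono) auto
  finally have scanned: "Suc (count_list S u) \<le> card (set (adj ! u) \<inter> set q)" .
  have len: "length (adj ! u) = card (set (adj ! u))"
    using sym u unfolding symmetric_lists_def by (simp add: distinct_card)
  have "card (set (adj ! u) \<inter> set q) \<le> card (set (adj ! u))"
    by (intro card_mono) auto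
  with scanned d[OF u] len show pos: "0 < d u"
    by linarith
  \<comment> \<open>If \<open>d u = t\<close>, then \<open>u\<close> has
    \<open>t + count_list S u\<close> neighbours, of which at least
    \<open>count_list S u + 1\<close> are queued. Fewer than \<open>t\<close> remain for a core,
    which avoids the queue.\<close>
  have new: "u \<notin> W" if W: "core adj t W" and eq: "d u = t" for W
  proof
    assume "u \<in> W"
    then have "t \<le> card (set (adj ! u) \<inter> W)"
      using W unfolding core_def by blast
    moreover have "card (set (adj ! u) \<inter> W) + card (set (adj ! u) \<inter> set q)
        = card ((set (adj ! u) \<inter> W) \<union> (set (adj ! u) \<inter> set q))"
      using cores[OF W] by (intro card_Un_disjoint[symmetric]) auto
    moreover have "\<dots> \<le> card (set (adj ! u))"
      by (intro card_mono) auto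
    ultimately show False
      using scanned d[OF u] len eq by linarith
  qed
  show "peeling adj t (if d u = t then q @ [u] else q) h (S @ [u]) R (d(u := d u - 1))"
    unfolding peeling_def
  proof (intro conjI allI impI)
    show "distinct (if d u = t then q @ [u] else q)"
      using q less[OF u] by auto
    show "set (if d u = t then q @ [u] else q) \<subseteq> {..<length adj}"
      using q u by auto
    show "h \<le> length (if d u = t then q @ [u] else q)"
      using q by auto
    show "(S @ [u]) @ R = concat (map ((!) adj) (take h (if d u = t then q @ [u] else q)))"
      using S q by auto
  next
    fix v
    assume v: "v < length adj"
    show "(d(u := d u - 1)) v + count_list (S @ [u]) v = length (adj ! v)"
      using d[OF v] pos by auto
    show "v \<in> set (if d u = t then q @ [u] else q) \<longleftrightarrow> (d(u := d u - 1)) v < t"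
      using less[OF v] pos by auto
  next
    fix W
    assume "core adj t W"
    then show "W \<inter> set (if d u = t then q @ [u] else q) = {}"
      using cores new by auto
  qed
qed

text \<open>Once the lists of all queued vertices are scanned, each counter is the number of
  unqueued neighbours. The unqueued vertices therefore form a core, which contains every other
  core.\<close>

lemma peeling_finished:
  assumes sym: "symmetric_lists adj" and inv: "peeling adj t q (length q) S [] d"
  shows "length q = length adj \<longleftrightarrow> (\<forall>W. core adj t W \<longrightarrow> W = {})"
proof -
  have q: "distinct q" "set q \<subseteq> {..<length adj}"
    and S: "S = concat (map ((!) adj) q)"
    and d: "\<And>v. v < length adj \<Longrightarrow> d v + count_list S v = length (adj ! v)"
    and less: "\<And>v. v < length adj \<Longrightarrow> v \<in> set q \<longleftrightarrow> d v < t"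
    and cores: "\<And>W. core adj t W \<Longrightarrow> W \<inter> set q = {}"
    using inv unfolding peeling_def by auto
  have "length q = length adj \<longleftrightarrow> set q = {..<length adj}"
    using q card_subset_eq[of "{..<length adj}" "set q"] by (auto simp: distinct_card dest: arg_cong[of _ _ card])
  moreover have "core adj t ({..<length adj} - set q)"
    unfolding core_def
  proof (intro conjI ballI)
    fix u
    assume u: "u \<in> {..<length adj} - set q"
    then have ul: "u < length adj" "t \<le> d u"
      using less by auto
    have "card (set (adj ! u)) = card (set (adj ! u) \<inter> set q) + card (set (adj ! u) - set q)"
      by (metis List.finite_set card_Int_Diff)
    moreover have "length (adj ! u) = card (set (adj ! u))"
      using sym ul unfolding symmetric_lists_def by (simp add: distinct_card)
    moreover have "set (adj ! u) \<inter> ({..<length adj} - set q) = set (adj ! u) - set q"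
      using sym ul unfolding symmetric_lists_def by blast
    ultimately show "t \<le> card (set (adj ! u) \<inter> ({..<length adj} - set q))"
      using d[OF ul(1)] ul(2) count_list_concat_lists[OF sym q ul(1)] S by simp
  qed auto
  ultimately show ?thesis
    using cores q unfolding core_def by (metis Diff_cancel Diff_eq_empty_iff inf.absorb1 subset_antisym)
qed

text \<open>Bounds the total scanning work, as queue entries are distinct.\<close>

lemma sum_length_lists_le:
  assumes "distinct q" "set q \<subseteq> {..<length adj}"
  shows "length (concat (map ((!) adj) q)) \<le> length (concat adj)"
proof -
  have "length (concat (map ((!) adj) q)) = (\<Sum>u\<in>set q. length (adj ! u))"
    using assms by (simp add: length_concat sum_list_distinct_conv_sum_set)
  also have "\<dots> \<le> (\<Sum>u<length adj. length (adj ! u))"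
    using assms by (intro sum_mono2) auto
  also have "\<dots> = length (concat adj)"
    by (simp add: length_concat sum_list_sum_nth atLeast0LessThan)
  finally show ?thesis .
qed

section \<open>Colorings versus cores, and the size of the input\<close>

lemma symmetric_lists_adjacency_lists:
  assumes "adjacency_lists V E vs adj"
  shows "symmetric_lists adj"
  using assms unfolding adjacency_lists_def symmetric_lists_def by (auto simp: insert_commute)

lemma equitable_tree_coloring_iff_no_core:
  assumes G: "proper_interval_graph V E" and A: "adjacency_lists V E vs adj" and k: "k > 0"
  shows "(\<exists>col. equitable_tree_coloring V E k col) \<longleftrightarrow> (\<forall>W. core adj (2 * k) W \<longrightarrow> W = {})"
proof
  obtain T where T: "proper_interval_representation V E T" and simple: "simple_graph V E"
    using G unfolding proper_interval_graph_def by blast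
  then have fin: "finite V" and loopless: "\<And>v. {v} \<notin> E"
    unfolding simple_graph_def by force+
  have vs: "distinct vs" "set vs = V" "length adj = length vs"
    and adj: "\<And>i. i < length vs \<Longrightarrow> set (adj ! i) = {j. j < length vs \<and> {vs ! i, vs ! j} \<in> E}"
    using A unfolding adjacency_lists_def by blast+
  have inj: "inj_on ((!) vs) {..<length vs}"
    using vs by (simp add: inj_on_nth)
  {
    assume "\<exists>col. equitable_tree_coloring V E k col"
    then obtain col where col: "equitable_tree_coloring V E k col" ..
    show "\<forall>W. core adj (2 * k) W \<longrightarrow> W = {}"
    proof (intro allI impI, rule ccontr)
      fix W
      assume W: "core adj (2 * k) W" "W \<noteq> {}"
      then have Wn: "W \<subseteq> {..<length vs}"
        using vs unfolding core_def by simp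
      then have sub: "(!) vs ` W \<subseteq> V"
        using vs by auto
      obtain v where v: "v \<in> (!) vs ` W"
        and K: "clique E (insert v {u \<in> (!) vs ` W. u \<noteq> v \<and> {v, u} \<in> E})" (is "clique E (insert v ?N)")
        using ex_simplicial[OF T fin sub] W by blast
      obtain i where i: "i \<in> W" "v = vs ! i"
        using v by blast
      have finN: "finite ?N"
        using Wn finite_subset by fastforce
      have nbrs: "(!) vs ` (set (adj ! i) \<inter> W) \<subseteq> ?N"
      proof
        fix x
        assume "x \<in> (!) vs ` (set (adj ! i) \<inter> W)"
        then obtain j where j: "x = vs ! j" "j \<in> set (adj ! i)" "j \<in> W"
          by blast
        then have "{v, x} \<in> E"
          using adj[of i] i Wn by auto
        then show "x \<in> ?N"
          using loopless[of v] j by auto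
      qed
      have "2 * k \<le> card (set (adj ! i) \<inter> W)"
        using W i unfolding core_def by blast
      also have "\<dots> = card ((!) vs ` (set (adj ! i) \<inter> W))"
        using Wn by (intro card_image[symmetric] inj_on_subset[OF inj]) auto
      also have "\<dots> \<le> card ?N"
        by (rule card_mono[OF finN nbrs])
      \<comment> \<open>The simplicial vertex itself makes the inequality strict.\<close>
      finally have "2 * k < card (insert v ?N)"
        using finN by simp
      moreover have "card (insert v ?N) \<le> 2 * k"
        using clique_le_if_equitable_tree_coloring[OF col fin _ K] sub v by blast
      ultimately show False
        by simp
    qed
  next
    assume no: "\<forall>W. core adj (2 * k) W \<longrightarrow> W = {}"
    show "\<exists>col. equitable_tree_coloring V E k col"
    proof (rule equitable_tree_coloring_if_cliques_le[OF G k], rule ccontr)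
      fix K
      assume K: "K \<subseteq> V" "clique E K" and big: "\<not> card K \<le> 2 * k"
      define W where "W = {i. i < length vs \<and> vs ! i \<in> K}"
      have img: "(!) vs ` W = K"
        using K vs unfolding W_def by (auto simp: in_set_conv_nth) (metis in_set_conv_nth subsetD image_eqI mem_Collect_eq)
      have injW: "inj_on ((!) vs) W"
        by (rule inj_on_subset[OF inj]) (auto simp: W_def)
      have cardW: "card W = card K"
        using card_image[OF injW] img by simp
      have "core adj (2 * k) W"
        unfolding core_def
      proof (intro conjI ballI)
        show "W \<subseteq> {..<length adj}"
          using vs by (auto simp: W_def)
      next
        fix i
        assume i: "i \<in> W"
        have "W - {i} \<subseteq> set (adj ! i) \<inter> W"
        proof
          fix j
          assume j: "j \<in> W - {i}"
          then have "vs ! i \<noteq> vs ! j"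
            using i inj_onD[OF injW, of i j] by auto
          then have "{vs ! i, vs ! j} \<in> E"
            using K(2) i j unfolding clique_def W_def by simp
          then show "j \<in> set (adj ! i) \<inter> W"
            using adj[of i] i j unfolding W_def by simp
        qed
        then have "card (W - {i}) \<le> card (set (adj ! i) \<inter> W)"
          by (intro card_mono) auto
        then show "2 * k \<le> card (set (adj ! i) \<inter> W)"
          using i big cardW by (simp add: card_Diff_singleton_if)
      qed
      then show False
        using no cardW big by auto
    qed
  }
qed

text \<open>The handshake lemma: incidences of vertices and edges are counted in two ways by
  \<open>sum_multicount\<close>.\<close>

lemma length_concat_adjacency_lists:
  assumes "simple_graph V E" "adjacency_lists V E vs adj"
  shows "length (concat adj) = 2 * card E"
proof -
  have V: "finite V" and E: "\<And>e. e \<in> E \<Longrightarrow> e \<subseteq> V \<and> card e = 2"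
    using assms(1) unfolding simple_graph_def by blast+
  have finE: "finite E"
    using V E by (meson Pow_iff finite_Pow_iff finite_subset subsetI)
  have vs: "distinct vs" "set vs = V" "length adj = length vs"
    and adj: "\<And>i. i < length vs \<Longrightarrow> distinct (adj ! i) \<and> set (adj ! i) = {j. j < length vs \<and> {vs ! i, vs ! j} \<in> E}"
    using assms(2) unfolding adjacency_lists_def by blast+
  have inj: "inj_on ((!) vs) {..<length vs}"
    using vs by (simp add: inj_on_nth)
  have deg: "length (adj ! i) = card {e \<in> E. vs ! i \<in> e}" if i: "i < length vs" for i
  proof -
    have "bij_betw (\<lambda>j. {vs ! i, vs ! j}) (set (adj ! i)) {e \<in> E. vs ! i \<in> e}"
    proof (rule bij_betw_imageI)
      show "inj_on (\<lambda>j. {vs ! i, vs ! j}) (set (adj ! i))"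
        using adj[OF i] inj by (auto simp: inj_on_def doubleton_eq_iff)
      show "(\<lambda>j. {vs ! i, vs ! j}) ` set (adj ! i) = {e \<in> E. vs ! i \<in> e}"
      proof (intro equalityI subsetI)
        fix e
        assume e: "e \<in> {e \<in> E. vs ! i \<in> e}"
        then obtain y where "e = {vs ! i, y}"
          using E[of e] by (auto simp: card_2_iff)
        moreover from this obtain j where "j < length vs" "y = vs ! j"
          using e E[of e] vs by (auto simp: in_set_conv_nth)
        ultimately show "e \<in> (\<lambda>j. {vs ! i, vs ! j}) ` set (adj ! i)"
          using adj[OF i] e by auto
      qed (use adj[OF i] in auto)
    qed
    then have "card (set (adj ! i)) = card {e \<in> E. vs ! i \<in> e}"
      by (rule bij_betw_same_card)
    moreover have "card (set (adj ! i)) = length (adj ! i)"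
      using adj[OF i] by (intro distinct_card) simp
    ultimately show ?thesis
      by (simp only:)
  qed
  have inc: "card {i \<in> {..<length vs}. vs ! i \<in> e} = 2" if e: "e \<in> E" for e
  proof -
    have "(!) vs ` {i \<in> {..<length vs}. vs ! i \<in> e} = e"
      using E[OF e] vs by (force simp: in_set_conv_nth)
    moreover have "card ((!) vs ` {i \<in> {..<length vs}. vs ! i \<in> e}) = card {i \<in> {..<length vs}. vs ! i \<in> e}"
      by (intro card_image inj_on_subset[OF inj]) auto
    ultimately show ?thesis
      using E[OF e] by simp
  qed
  have "length (concat adj) = (\<Sum>i<length vs. card {e \<in> E. vs ! i \<in> e})"
    using vs(3) deg by (simp add: length_concat sum_list_sum_nth atLeast0LessThan)
  also have "\<dots> = 2 * card E"
    by (rule sum_multicount) (use finE inc in auto)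
  finally show ?thesis .
qed

section \<open>The machine\<close>

text \<open>Register 1 holds \<open>n\<close>, register 2 holds \<open>2 k\<close>, registers 3 and 4 hold the
  base addresses of the counters and of the queue, register 5 the address just behind the queue,
  and registers 10 and 11 the constants 0 and 1. From instruction 24 on, register 6 points to the
  next queue entry to be fetched, and registers 8 and 7 delimit the pending part of the current
  adjacency list.\<close>

definition peel_program :: "instr list" where
  "peel_program =
    [Const 11 1, Load 1 10, Load 2 11, Add 2 2 2, Add 3 11 11, Add 3 3 1, Load 3 3, Add 4 3 1, Move 5 4,
     Jump_eq 6 1 24,
     Add 7 6 11, Add 7 7 11, Load 8 7, Add 7 7 11, Load 7 7, Sub 7 7 8, Add 8 3 6, Store 8 7,
     Jump_less 7 2 20, Jump 22, Store 5 6, Add 5 5 11, Add 6 6 11, Jump 9,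
     Move 6 4, Move 7 8,
     Jump_eq 8 7 38,
     Load 9 8, Add 8 8 11, Add 12 3 9, Load 13 12, Jump_eq 13 2 33, Jump 35,
     Store 5 9, Add 5 5 11, Sub 13 13 11, Store 12 13, Jump 26,
     Jump_eq 6 5 47,
     Load 7 6, Add 6 6 11, Add 7 7 11, Add 7 7 11, Load 8 7, Add 7 7 11, Load 7 7, Jump 26,
     Add 7 4 1, Jump_eq 5 7 50, Jump 51, Move 0 11]"

section \<open>Addresses in the encoded instance and the word length\<close>

definition offset :: "nat list list \<Rightarrow> nat \<Rightarrow> nat" where
  "offset adj i = length adj + 3 + length (concat (take i adj))"

lemma encode_instance_nth:
  "encode_instance adj k ! 0 = length adj"
  "encode_instance adj k ! Suc 0 = k"
  "i \<le> length adj \<Longrightarrow> encode_instance adj k ! Suc (Suc i) = offset adj i"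
  "encode_instance adj k ! (length adj + 3 + j) = concat adj ! j"
  by (simp_all add: encode_instance_def offset_def nth_append del: upt_Suc)

text \<open>The end address of the last list is thus the first free cell. The counters start
  there.\<close>

lemma length_encode_instance: "length (encode_instance adj k) = offset adj (length adj)"
  by (simp add: encode_instance_def offset_def)

lemma offset_Suc: "i < length adj \<Longrightarrow> offset adj (Suc i) = offset adj i + length (adj ! i)"
  by (simp add: offset_def take_Suc_conv_app_nth)

lemma offset_le: "i \<le> length adj \<Longrightarrow> offset adj i \<le> offset adj (length adj)"
  by (metis add_le_cancel_left append_take_drop_id concat_append le_add1 length_append offset_def take_all_iff order_refl)

lemma offset_ge: "length adj + 3 \<le> offset adj i"
  by (simp add: offset_def)

lemma encode_instance_nth_list:
  assumes "i < length adj" "j < length (adj ! i)"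
  shows "encode_instance adj k ! (offset adj i + j) = adj ! i ! j"
proof -
  have "concat adj = concat (take i adj) @ adj ! i @ concat (drop (Suc i) adj)"
    using id_take_nth_drop[OF assms(1)] by (metis concat.simps(2) concat_append)
  then have "concat adj ! (length (concat (take i adj)) + j) = adj ! i ! j"
    using assms by (simp add: nth_append)
  then show ?thesis
    using encode_instance_nth(4)[of adj k "length (concat (take i adj)) + j"]
    by (simp add: offset_def add.assoc)
qed

text \<open>The constant 4 gives \<open>B ^ 4 \<le> 2 ^ w\<close>, and \<open>3 \<le> B\<close>
  because even the empty graph is encoded in three cells. The factor 3 covers the input, the
  \<open>n\<close> counters and the \<open>n\<close> queue cells, so no address wraps
  around.\<close>

lemma word_size_sufficient:
  assumes "sufficient_word_length 4 (encode_instance adj k) w"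
  shows "3 * offset adj (length adj) < 2 ^ w" "2 * k < 2 ^ w"
proof -
  define B where "B = input_bound (encode_instance adj k)"
  have k: "k \<le> B" and L: "offset adj (length adj) \<le> B"
    unfolding B_def input_bound_def length_encode_instance[of adj k, symmetric]
    by (auto intro!: Max_ge simp: encode_instance_def)
  have B: "3 \<le> B"
    using L offset_ge[of adj "length adj"] by simp
  have "real w \<ge> 4 * log 2 (real B)"
    using assms B by (simp add: sufficient_word_length_def B_def)
  then have "2 powr (real w) \<ge> 2 powr (4 * log 2 (real B))"
    by simp
  moreover have "2 powr (4 * log 2 (real B)) = (2 powr log 2 (real B)) powr 4"
    by (simp add: powr_powr mult.commute)
  ultimately have "real (2 ^ w) \<ge> real (B ^ 4)"
    using B by (simp add: powr_realpow)
  then have "B ^ 4 \<le> 2 ^ w"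
    by (simp only: of_nat_le_iff)
  moreover have "9 * B \<le> B ^ 4"
    using B mult_le_mono[OF power_mono[OF B, of 3] order_refl[of B]]
    by (simp add: power4_eq_xxxx power3_eq_cube)
  ultimately have "9 * B \<le> 2 ^ w"
    by simp
  then show "3 * offset adj (length adj) < 2 ^ w" "2 * k < 2 ^ w"
    using k L B by auto
qed

text \<open>Peels off the first step instead of the last, so that the simplifier executes the
  program instruction by instruction on an explicit configuration.\<close>

lemma funpow_numeral_right: "(f ^^ numeral m) x = (f ^^ pred_numeral m) (f x)"
  by (simp add: numeral_eq_Suc funpow_Suc_right del: funpow.simps)

lemma step_peel_program:
  "p < 51 \<Longrightarrow> step w peel_program \<lparr>pc = p, reg = r, mem = m\<rparr> =
     exec w (peel_program ! p) \<lparr>pc = p, reg = r, mem = m\<rparr>"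
  by (simp add: step_def halted_def peel_program_def)

lemma peel_program_nth:
  "peel_program ! 0 = Const 11 1" "peel_program ! Suc 0 = Load 1 10" "peel_program ! 2 = Load 2 11"
  "peel_program ! 3 = Add 2 2 2" "peel_program ! 4 = Add 3 11 11" "peel_program ! 5 = Add 3 3 1"
  "peel_program ! 6 = Load 3 3" "peel_program ! 7 = Add 4 3 1" "peel_program ! 8 = Move 5 4"
  "peel_program ! 9 = Jump_eq 6 1 24" "peel_program ! 10 = Add 7 6 11" "peel_program ! 11 = Add 7 7 11"
  "peel_program ! 12 = Load 8 7" "peel_program ! 13 = Add 7 7 11" "peel_program ! 14 = Load 7 7"
  "peel_program ! 15 = Sub 7 7 8" "peel_program ! 16 = Add 8 3 6" "peel_program ! 17 = Store 8 7"
  "peel_program ! 18 = Jump_less 7 2 20" "peel_program ! 19 = Jump 22" "peel_program ! 20 = Store 5 6"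
  "peel_program ! 21 = Add 5 5 11" "peel_program ! 22 = Add 6 6 11" "peel_program ! 23 = Jump 9"
  "peel_program ! 24 = Move 6 4" "peel_program ! 25 = Move 7 8" "peel_program ! 26 = Jump_eq 8 7 38"
  "peel_program ! 27 = Load 9 8" "peel_program ! 28 = Add 8 8 11" "peel_program ! 29 = Add 12 3 9"
  "peel_program ! 30 = Load 13 12" "peel_program ! 31 = Jump_eq 13 2 33" "peel_program ! 32 = Jump 35"
  "peel_program ! 33 = Store 5 9" "peel_program ! 34 = Add 5 5 11" "peel_program ! 35 = Sub 13 13 11"
  "peel_program ! 36 = Store 12 13" "peel_program ! 37 = Jump 26" "peel_program ! 38 = Jump_eq 6 5 47"
  "peel_program ! 39 = Load 7 6" "peel_program ! 40 = Add 6 6 11" "peel_program ! 41 = Add 7 7 11"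
  "peel_program ! 42 = Add 7 7 11" "peel_program ! 43 = Load 8 7" "peel_program ! 44 = Add 7 7 11"
  "peel_program ! 45 = Load 7 7" "peel_program ! 46 = Jump 26" "peel_program ! 47 = Add 7 4 1"
  "peel_program ! 48 = Jump_eq 5 7 50" "peel_program ! 49 = Jump 51" "peel_program ! 50 = Move 0 11"
  by (simp_all add: peel_program_def)

lemmas run_simps = funpow_numeral_right step_peel_program peel_program_nth set_reg_def jump_if_def

text \<open>The number \<open>m\<close> is a time budget: a round that does not finish takes at
  least one step and pays for all its steps, so the budget strictly decreases.\<close>

lemma loop_time:
  assumes step: "\<And>s m. I s m \<Longrightarrow>
      (\<exists>i\<le>m. Q ((f ^^ i) s)) \<or> (\<exists>i m'. 0 < i \<and> i + m' \<le> m \<and> I ((f ^^ i) s) m')"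
    and "I s m"
  shows "\<exists>i\<le>m. Q ((f ^^ i) s)"
  using \<open>I s m\<close>
proof (induction m arbitrary: s rule: less_induct)
  case (less m)
  consider "\<exists>i\<le>m. Q ((f ^^ i) s)"
    | i m' where "0 < i" "i + m' \<le> m" "I ((f ^^ i) s) m'"
    using step[OF less.prems] by blast
  then show ?case
  proof cases
    case 2
    then obtain j where "j \<le> m'" "Q ((f ^^ j) ((f ^^ i) s))"
      using less.IH[of m' "(f ^^ i) s"] by auto
    then show ?thesis
      using 2 by (intro exI[of _ "j + i"]) (simp add: funpow_add)
  qed
qed

lemma sub_mod_word: "b \<le> a \<Longrightarrow> a - b < W \<Longrightarrow> (a + W - b) mod W = a - (b::nat)"
  by (metis Nat.add_diff_assoc2 mod_add_self2 mod_less)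

text \<open>The part of the invariant common to both loops. The counters are left out because they
  hold degrees while being filled in, but remaining degrees during the peeling.\<close>

definition layout :: "nat list list \<Rightarrow> nat \<Rightarrow> (nat \<Rightarrow> nat) \<Rightarrow> (nat \<Rightarrow> nat) \<Rightarrow> nat list \<Rightarrow> bool" where
  "layout adj k r m q \<longleftrightarrow>
     r 0 = 0 \<and> r 1 = length adj \<and> r 2 = 2 * k \<and> r 3 = offset adj (length adj) \<and>
     r 4 = offset adj (length adj) + length adj \<and> r 11 = 1 \<and>
     (\<forall>j<offset adj (length adj). m j = encode_instance adj k ! j) \<and>
     r 5 = offset adj (length adj) + length adj + length q \<and>
     (\<forall>j<length q. m (offset adj (length adj) + length adj + j) = q ! j)"

definition filling_state :: "nat list list \<Rightarrow> nat \<Rightarrow> nat \<Rightarrow> config \<Rightarrow> bool" where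
  "filling_state adj k i s \<longleftrightarrow> (\<exists>r m. s = \<lparr>pc = 9, reg = r, mem = m\<rparr> \<and> i \<le> length adj \<and> r 6 = i \<and>
     layout adj k r m (filter (\<lambda>u. length (adj ! u) < 2 * k) [0..<i]) \<and>
     (\<forall>j<i. m (offset adj (length adj) + j) = length (adj ! j)))"

definition peeling_state ::
    "nat list list \<Rightarrow> nat \<Rightarrow> nat list \<Rightarrow> nat \<Rightarrow> nat list \<Rightarrow> nat list \<Rightarrow> config \<Rightarrow> bool" where
  "peeling_state adj k q h S R s \<longleftrightarrow> (\<exists>r m d. s = \<lparr>pc = 26, reg = r, mem = m\<rparr> \<and>
     peeling adj (2 * k) q h S R d \<and> layout adj k r m q \<and>
     r 6 = offset adj (length adj) + length adj + h \<and>
     r 7 = r 8 + length R \<and>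
     (\<forall>j<length R. r 8 + j < offset adj (length adj) \<and> encode_instance adj k ! (r 8 + j) = R ! j) \<and>
     (\<forall>u<length adj. m (offset adj (length adj) + u) = d u))"

lemma peeling_stateI:
  assumes "peeling adj (2 * k) q h S R d" "layout adj k r m q"
    "r 6 = offset adj (length adj) + length adj + h" "r 7 = r 8 + length R"
    "\<And>j. j < length R \<Longrightarrow> r 8 + j < offset adj (length adj) \<and> encode_instance adj k ! (r 8 + j) = R ! j"
    "\<And>u. u < length adj \<Longrightarrow> m (offset adj (length adj) + u) = d u"
  shows "peeling_state adj k q h S R \<lparr>pc = 26, reg = r, mem = m\<rparr>"
  using assms unfolding peeling_state_def by blast

section \<open>Correctness and running time of the program\<close>

context
  fixes adj :: "nat list list" and k w :: nat
  assumes sym: "symmetric_lists adj" and k: "k > 0"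
    and word: "3 * offset adj (length adj) < 2 ^ w" "2 * k < 2 ^ w"
begin

private abbreviation "n \<equiv> length adj"
private abbreviation "base \<equiv> offset adj (length adj)"
private abbreviation "run i \<equiv> step w peel_program ^^ i"

lemma n_less_base: "n + 3 \<le> base"
  by (rule offset_ge)

lemma init_state: "filling_state adj k 0 (run 9 (init_config (encode_instance adj k)))"
proof -
  \<comment> \<open>Otherwise the constant 1 would be reduced to 0.\<close>
  have "w > 0"
    using word n_less_base by (cases w) auto
  \<comment> \<open>Cell \<open>n + 2\<close> holds the last of the \<open>n + 1\<close> addresses;
    the program loads its base address from there.\<close>
  moreover have "encode_instance adj k ! (n + 2) = base"
    using encode_instance_nth(3)[of n adj k] by simp
  ultimately show ?thesis
    using word n_less_base
    unfolding filling_state_def layout_def init_config_def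
    by (simp add: run_simps encode_instance_nth length_encode_instance mult_2 flip: numeral_2_eq_2)
qed

text \<open>One round takes 14 instructions if vertex \<open>i\<close> is enqueued and 13
  otherwise.\<close>

lemma filling_step:
  assumes s: "filling_state adj k i s" and i: "i < n"
  shows "\<exists>j. 0 < j \<and> j \<le> 14 \<and> filling_state adj k (Suc i) (run j s)"
proof -
  obtain r m where s_eq: "s = \<lparr>pc = 9, reg = r, mem = m\<rparr>" and r6: "r 6 = i"
    and L: "layout adj k r m (filter (\<lambda>u. length (adj ! u) < 2 * k) [0..<i])" (is "layout _ _ _ _ ?q")
    and deg: "\<And>j. j < i \<Longrightarrow> m (base + j) = length (adj ! j)"
    using s unfolding filling_state_def by blast
  have q: "length ?q \<le> i"
    using length_filter_le[of _ "[0..<i]"] by simp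
  have regs: "r 0 = 0" "r 1 = n" "r (Suc 0) = n" "r 2 = 2 * k" "r 3 = base" "r 4 = base + n" "r 11 = 1"
      "r 5 = base + n + length ?q"
    and inp: "\<And>j. j < base \<Longrightarrow> m j = encode_instance adj k ! j"
    and queue: "\<And>j. j < length ?q \<Longrightarrow> m (base + n + j) = ?q ! j"
    using L unfolding layout_def by auto
  have off: "m (Suc (Suc i)) = offset adj i" "m (Suc (Suc (Suc i))) = offset adj i + length (adj ! i)"
    using inp n_less_base i by (simp_all add: encode_instance_nth offset_Suc)
  have len: "offset adj i + length (adj ! i) \<le> base"
    using offset_le[of "Suc i" adj] i by (simp add: offset_Suc)
  have small: "Suc (Suc (Suc i)) < 2 ^ w" "base + i < 2 ^ w" "Suc (base + n + length ?q) < 2 ^ w"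
    "Suc i < 2 ^ w" "Suc (Suc i) < 2 ^ w" "length (adj ! i) < 2 ^ w"
    using word n_less_base i q len by linarith+
  have sub: "(offset adj i + length (adj ! i) + 2 ^ w - offset adj i) mod 2 ^ w = length (adj ! i)"
    using small by (subst sub_mod_word) auto
  show ?thesis
  proof (cases "length (adj ! i) < 2 * k")
    case True
    have "run 14 s = \<lparr>pc = 9, reg = r(7 := length (adj ! i), 8 := base + i, 5 := Suc (r 5), 6 := Suc i),
        mem = m(base + i := length (adj ! i), r 5 := i)\<rparr>"
      using True i small sub off regs r6 by (simp add: s_eq run_simps fun_upd_twist)
    moreover have "filling_state adj k (Suc i) \<dots>"
      unfolding filling_state_def layout_def
      using True regs inp queue deg i q by (auto simp: nth_append less_Suc_eq)
    ultimately show ?thesis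
      by (intro exI[of _ 14]) simp
  next
    case False
    have "run 13 s = \<lparr>pc = 9, reg = r(7 := length (adj ! i), 8 := base + i, 6 := Suc i),
        mem = m(base + i := length (adj ! i))\<rparr>"
      using False i small sub off regs r6 by (simp add: s_eq run_simps fun_upd_twist)
    moreover have "filling_state adj k (Suc i) \<dots>"
      unfolding filling_state_def layout_def
      using False regs inp queue deg i q by (auto simp: less_Suc_eq)
    ultimately show ?thesis
      by (intro exI[of _ 13]) simp
  qed
qed

lemma filling_done:
  assumes s: "filling_state adj k n s"
  shows "\<exists>q. peeling_state adj k q 0 [] [] (run 3 s)"
proof -
  obtain r m where s_eq: "s = \<lparr>pc = 9, reg = r, mem = m\<rparr>" and r6: "r 6 = n"
    and L: "layout adj k r m (filter (\<lambda>u. length (adj ! u) < 2 * k) [0..<n])" (is "layout _ _ _ _ ?q")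
    and deg: "\<And>j. j < n \<Longrightarrow> m (base + j) = length (adj ! j)"
    using s unfolding filling_state_def by blast
  have r: "r (Suc 0) = n" "r 4 = base + n"
    using L by (simp_all add: layout_def)
  have run: "run 3 s = \<lparr>pc = 26, reg = r(6 := r 4, 7 := r 8), mem = m\<rparr>"
    using r6 r by (simp add: s_eq run_simps)
  have "peeling_state adj k ?q 0 [] [] (run 3 s)"
    unfolding run using peeling_init[of adj "2 * k"]
    by (rule peeling_stateI) (use L deg r in \<open>auto simp: layout_def\<close>)
  then show ?thesis ..
qed

text \<open>One round takes 11 instructions if \<open>u\<close> is enqueued and 10 otherwise. The
  decrement cannot wrap around, as \<open>peeling_scan\<close> keeps the counter positive
  beforehand.\<close>

lemma peeling_state_scan:
  assumes s: "peeling_state adj k q h S (u # R) s"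
  shows "\<exists>j q'. 0 < j \<and> j \<le> 11 \<and> peeling_state adj k q' h (S @ [u]) R (run j s)"
proof -
  obtain r m d where s_eq: "s = \<lparr>pc = 26, reg = r, mem = m\<rparr>"
    and P: "peeling adj (2 * k) q h S (u # R) d" and L: "layout adj k r m q"
    and r6: "r 6 = base + n + h" and r7: "r 7 = r 8 + Suc (length R)"
    and R: "\<And>j. j < Suc (length R) \<Longrightarrow> r 8 + j < base \<and> encode_instance adj k ! (r 8 + j) = (u # R) ! j"
    and d: "\<And>v. v < n \<Longrightarrow> m (base + v) = d v"
    using s unfolding peeling_state_def by auto
  have regs: "r 0 = 0" "r 1 = n" "r (Suc 0) = n" "r 2 = 2 * k" "r 3 = base" "r 4 = base + n" "r 11 = 1"
      "r 5 = base + n + length q"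
    and inp: "\<And>j. j < base \<Longrightarrow> m j = encode_instance adj k ! j"
    and queue: "\<And>j. j < length q \<Longrightarrow> m (base + n + j) = q ! j"
    using L unfolding layout_def by auto
  note scan = peeling_scan[OF sym P]
  have u: "m (r 8) = u"
    using inp[of "r 8"] R[of 0] by simp
  have "length q = card (set q)" "set q \<subseteq> {..<n}" "length (adj ! u) = d u + count_list S u"
    using P scan(1) unfolding peeling_def by (auto simp: distinct_card)
  moreover have "length (adj ! u) \<le> base"
    using offset_le[of "Suc u" adj] scan(1) by (simp add: offset_Suc)
  ultimately have q: "length q \<le> n" and "d u \<le> base"
    using card_mono[of "{..<n}" "set q"] by auto
  then have small: "base + u < 2 ^ w" "Suc (r 8) < 2 ^ w" "Suc (base + n + length q) < 2 ^ w" "d u < 2 ^ w"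
    using word n_less_base R[of 0] scan(1) by linarith+
  have sub: "(d u + 2 ^ w - Suc 0) mod 2 ^ w = d u - Suc 0"
    using small scan(2) by (subst sub_mod_word) auto
  have R': "Suc (r 8 + j) < base \<and> encode_instance adj k ! Suc (r 8 + j) = R ! j" if "j < length R" for j
    using R[of "Suc j"] that by simp
  show ?thesis
  proof (cases "d u = 2 * k")
    case True
    have run: "run 11 s = \<lparr>pc = 26, reg = r(9 := u, 8 := Suc (r 8), 12 := base + u, 5 := Suc (r 5), 13 := d u - 1),
        mem = m(r 5 := u, base + u := d u - 1)\<rparr>"
      using True small sub u regs r7 d[OF scan(1)] scan(1,2) by (simp add: s_eq run_simps)
    have "peeling_state adj k (q @ [u]) h (S @ [u]) R (run 11 s)"
      unfolding run using scan(3)[unfolded if_P[OF True]]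
      by (rule peeling_stateI)
        (use regs inp queue r6 r7 R' d scan(1) in \<open>auto simp: nth_append less_Suc_eq layout_def\<close>)
    then show ?thesis
      by (intro exI[of _ 11] exI[of _ "q @ [u]"]) simp
  next
    case False
    have run: "run 10 s = \<lparr>pc = 26, reg = r(9 := u, 8 := Suc (r 8), 12 := base + u, 13 := d u - 1),
        mem = m(base + u := d u - 1)\<rparr>"
      using False small sub u regs r7 d[OF scan(1)] scan(1,2) by (simp add: s_eq run_simps)
    have "peeling_state adj k q h (S @ [u]) R (run 10 s)"
      unfolding run using scan(3)[unfolded if_not_P[OF False]]
      by (rule peeling_stateI) (use regs inp queue r6 r7 R' d scan(1) in \<open>auto simp: layout_def\<close>)
    then show ?thesis
      by (intro exI[of _ 10] exI[of _ q]) simp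
  qed
qed

lemma peeling_state_fetch:
  assumes s: "peeling_state adj k q h S [] s" and h: "h < length q"
  shows "peeling_state adj k q (Suc h) S (adj ! (q ! h)) (run 10 s)"
proof -
  obtain r m d where s_eq: "s = \<lparr>pc = 26, reg = r, mem = m\<rparr>"
    and P: "peeling adj (2 * k) q h S [] d" and L: "layout adj k r m q"
    and r6: "r 6 = base + n + h" and r7: "r 7 = r 8"
    and d: "\<And>v. v < n \<Longrightarrow> m (base + v) = d v"
    using s unfolding peeling_state_def by auto
  have regs: "r 0 = 0" "r 1 = n" "r (Suc 0) = n" "r 2 = 2 * k" "r 3 = base" "r 4 = base + n" "r 11 = 1"
      "r 5 = base + n + length q"
    and inp: "\<And>j. j < base \<Longrightarrow> m j = encode_instance adj k ! j"
    and queue: "\<And>j. j < length q \<Longrightarrow> m (base + n + j) = q ! j"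
    using L unfolding layout_def by auto
  define v where "v = q ! h"
  have v: "v < n"
    using P subsetD[OF _ nth_mem[OF h], of "{..<n}"] unfolding peeling_def v_def by simp
  have "length q = card (set q)" "set q \<subseteq> {..<n}"
    using P unfolding peeling_def by (auto simp: distinct_card)
  then have q: "length q \<le> n"
    using card_mono[of "{..<n}" "set q"] by auto
  have off: "m (Suc (Suc v)) = offset adj v" "m (Suc (Suc (Suc v))) = offset adj v + length (adj ! v)"
    using inp n_less_base v by (simp_all add: encode_instance_nth offset_Suc)
  have len: "offset adj v + length (adj ! v) \<le> base"
    using offset_le[of "Suc v" adj] v by (simp add: offset_Suc)
  have small: "Suc (Suc (Suc v)) < 2 ^ w" "Suc v < 2 ^ w" "Suc (Suc v) < 2 ^ w" "Suc (base + n + h) < 2 ^ w"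
    using word n_less_base v q h by linarith+
  have mv: "m (base + n + h) = v"
    using queue[OF h] by (simp add: v_def)
  have run: "run 10 s = \<lparr>pc = 26, reg = r(6 := Suc (r 6), 8 := offset adj v, 7 := offset adj v + length (adj ! v)), mem = m\<rparr>"
    using small regs off r6 r7 mv h by (simp add: s_eq run_simps fun_upd_twist)
  show ?thesis
    unfolding run using peeling_fetch[OF P h]
    by (rule peeling_stateI)
      (use L r6 len d encode_instance_nth_list[OF v] in \<open>auto simp: layout_def simp flip: v_def\<close>)
qed

text \<open>The queue is full iff its end address is \<open>base + n + n\<close>; only then does the
  last instruction put 1 into register 0, which has been 0 so far.\<close>

lemma peeling_state_done:
  assumes s: "peeling_state adj k q (length q) S [] s"
  shows "\<exists>j\<le>5. halted peel_program (run j s) \<and>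
    reg (run j s) 0 = (if \<forall>W. core adj (2 * k) W \<longrightarrow> W = {} then 1 else 0)"
proof -
  obtain r m d where s_eq: "s = \<lparr>pc = 26, reg = r, mem = m\<rparr>"
    and P: "peeling adj (2 * k) q (length q) S [] d" and L: "layout adj k r m q"
    and r6: "r 6 = base + n + length q" and r7: "r 7 = r 8"
    using s unfolding peeling_state_def by auto
  have regs: "r 0 = 0" "r (Suc 0) = n" "r 4 = base + n" "r 11 = 1" "r 5 = base + n + length q"
    using L unfolding layout_def by auto
  have small: "base + n + n < 2 ^ w"
    using word n_less_base by linarith
  have len: "length peel_program = 51"
    by (simp add: peel_program_def)
  have "halted peel_program (run 5 s) \<and> reg (run 5 s) 0 = (if length q = n then 1 else 0)"
    using small regs r6 r7 len by (simp add: s_eq run_simps halted_def)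
  then show ?thesis
    unfolding peeling_finished[OF sym P] by blast
qed

text \<open>Ensures that the truncated differences in the time budget really drop by one with each
  fetch and each scan.\<close>

lemma peeling_state_lengths:
  assumes "peeling_state adj k q h S R s"
  shows "h \<le> length q" "length q \<le> n" "length (S @ R) \<le> length (concat adj)"
proof -
  obtain d where P: "peeling adj (2 * k) q h S R d"
    using assms unfolding peeling_state_def by blast
  then have q: "distinct q" "set q \<subseteq> {..<n}" "S @ R = concat (map ((!) adj) (take h q))"
    unfolding peeling_def by auto
  show "h \<le> length q"
    using P unfolding peeling_def by blast
  show "length q \<le> n"
    using q card_mono[of "{..<n}" "set q"] by (simp add: distinct_card)
  show "length (S @ R) \<le> length (concat adj)"
    unfolding q(3) using q(1,2) set_take_subset[of h q] by (intro sum_length_lists_le) auto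
qed

lemma peel_program_correct:
  "\<exists>j \<le> 25 * n + 12 * length (concat adj) + 20.
     halted peel_program (run j (init_config (encode_instance adj k))) \<and>
     reg (run j (init_config (encode_instance adj k))) 0 = (if \<forall>W. core adj (2 * k) W \<longrightarrow> W = {} then 1 else 0)"
proof -
  define Q where "Q s \<longleftrightarrow> halted peel_program s \<and>
    reg s 0 = (if \<forall>W. core adj (2 * k) W \<longrightarrow> W = {} then 1 else 0)" for s
  \<comment> \<open>The budget: 14 per vertex still to be filled in, 3 for the transition, 10 per
    list still to be fetched, 12 per list entry (a scan takes at most 11), and 5 for the final
    test.\<close>
  define I where "I s t \<longleftrightarrow>
      (\<exists>i\<le>n. filling_state adj k i s \<and> t = 14 * (n - i) + 3 + (10 * n + 12 * length (concat adj) + 5)) \<or>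
      (\<exists>q h S R. peeling_state adj k q h S R s \<and> t = 10 * (n - h) + 12 * (length (concat adj) - length S) + 5)"
    for s t
  have progress: "(\<exists>i\<le>t. Q (run i s)) \<or> (\<exists>i t'. 0 < i \<and> i + t' \<le> t \<and> I (run i s) t')" if "I s t" for s t
    using that unfolding I_def[of s]
  proof (elim disjE exE conjE)
    fix i
    assume i: "i \<le> n" "filling_state adj k i s"
      and t: "t = 14 * (n - i) + 3 + (10 * n + 12 * length (concat adj) + 5)"
    show ?thesis
    proof (cases "i = n")
      case True
      then obtain q where "peeling_state adj k q 0 [] [] (run 3 s)"
        using filling_done i by blast
      then have "I (run 3 s) (10 * n + 12 * length (concat adj) + 5)"
        unfolding I_def by (metis diff_zero list.size(3))
      then show ?thesis
        using t by (intro disjI2 exI[of _ 3] exI conjI) auto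
    next
      case False
      with i have "i < n"
        by simp
      then obtain j where j: "0 < j" "j \<le> 14" "filling_state adj k (Suc i) (run j s)"
        using filling_step[OF i(2)] by blast
      then have "I (run j s) (14 * (n - Suc i) + 3 + (10 * n + 12 * length (concat adj) + 5))"
        using i False unfolding I_def by (intro disjI1 exI[of _ "Suc i"]) simp
      moreover have "j + (14 * (n - Suc i) + 3 + (10 * n + 12 * length (concat adj) + 5)) \<le> t"
        using t i False j by linarith
      ultimately show ?thesis
        using j by blast
    qed
  next
    fix q h S R
    assume s: "peeling_state adj k q h S R s"
      and t: "t = 10 * (n - h) + 12 * (length (concat adj) - length S) + 5"
    note len = peeling_state_lengths[OF s]
    show ?thesis
    proof (cases R)
      case (Cons u R')
      then obtain j q' where j: "0 < j" "j \<le> 11" "peeling_state adj k q' h (S @ [u]) R' (run j s)"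
        using peeling_state_scan s by blast
      then have "I (run j s) (10 * (n - h) + 12 * (length (concat adj) - length (S @ [u])) + 5)"
        unfolding I_def by blast
      moreover have "j + (10 * (n - h) + 12 * (length (concat adj) - length (S @ [u])) + 5) \<le> t"
        using t len Cons j by simp
      ultimately show ?thesis
        using j by blast
    next
      case Nil
      show ?thesis
      proof (cases "h < length q")
        case True
        then have "I (run 10 s) (10 * (n - Suc h) + 12 * (length (concat adj) - length S) + 5)"
          using peeling_state_fetch s Nil unfolding I_def by blast
        moreover have "10 + (10 * (n - Suc h) + 12 * (length (concat adj) - length S) + 5) \<le> t"
          using t len True by simp
        ultimately show ?thesis
          using zero_less_numeral by blast
      next
        case False
        then have "\<exists>j\<le>5. Q (run j s)"
          using peeling_state_done[of q S s] s Nil len unfolding Q_def by simp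
        then show ?thesis
          using t by (meson le_add2 order_trans)
      qed
    qed
  qed
  have "I (run 9 (init_config (encode_instance adj k))) (14 * n + 3 + (10 * n + 12 * length (concat adj) + 5))"
    unfolding I_def using init_state by (metis bot_nat_0.extremum diff_zero)
  then obtain j where j: "j \<le> 14 * n + 3 + (10 * n + 12 * length (concat adj) + 5)"
    "Q (run j (run 9 (init_config (encode_instance adj k))))"
    using loop_time[of I Q, OF progress] by blast
  then show ?thesis
    unfolding Q_def by (intro exI[of _ "j + 9"]) (simp add: funpow_add)
qed

end

theorem theorem4:
  shows "\<exists>(P :: instr list) (T :: nat \<Rightarrow> nat) (c :: nat).
    (\<lambda>N. real (T N)) \<in> O(\<lambda>N. real N) \<and>
    (\<forall>(V :: nat set) (E :: nat set set) (k :: nat) (vs :: nat list) (adj :: nat list list) (w :: nat).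
       proper_interval_graph V E \<and> k > 0 \<and>
       adjacency_lists V E vs adj \<and>
       sufficient_word_length c (encode_instance adj k) w \<longrightarrow>
       answers_within w P (encode_instance adj k) (T (card V + card E))
         (\<exists>col. equitable_tree_coloring V E k col))"
\<comment> \<open>The lists have \<open>2 * card E\<close> entries in total, so the term
  \<open>12 * length (concat adj)\<close> is \<open>24 * card E\<close>; this and the 25 per vertex
  fit into \<open>25 * N\<close>.\<close>
proof (intro exI[of _ peel_program] exI[of _ "\<lambda>N. 25 * N + 20"] exI[of _ 4] conjI allI impI)
  show "(\<lambda>N. real (25 * N + 20)) \<in> O(\<lambda>N. real N)"
    \<comment> \<open>For \<open>N \<ge> 1\<close> the additive 20 is at most \<open>20 * N\<close>,
      whence 45.\<close>
    by (intro bigoI[of _ 45] eventually_mono[OF eventually_ge_at_top[of 1]]) auto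
next
  fix V :: "nat set" and E k vs adj w
  assume A: "proper_interval_graph V E \<and> k > 0 \<and> adjacency_lists V E vs adj \<and>
    sufficient_word_length 4 (encode_instance adj k) w"
  then have simple: "simple_graph V E" and adj: "adjacency_lists V E vs adj"
    unfolding proper_interval_graph_def by auto
  have "length (concat adj) = 2 * card E"
    by (rule length_concat_adjacency_lists[OF simple adj])
  moreover have "length adj = card V"
    using adj distinct_card unfolding adjacency_lists_def by metis
  ultimately have time: "25 * length adj + 12 * length (concat adj) + 20 \<le> 25 * (card V + card E) + 20"
    by simp
  have col: "(\<exists>col. equitable_tree_coloring V E k col) \<longleftrightarrow> (\<forall>W. core adj (2 * k) W \<longrightarrow> W = {})"
    using A by (intro equitable_tree_coloring_iff_no_core[of V E vs]) simp_all
  obtain j where j: "j \<le> 25 * length adj + 12 * length (concat adj) + 20"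
    and run: "halted peel_program ((step w peel_program ^^ j) (init_config (encode_instance adj k)))"
      "reg ((step w peel_program ^^ j) (init_config (encode_instance adj k))) 0
         = (if \<forall>W. core adj (2 * k) W \<longrightarrow> W = {} then 1 else 0)"
    using peel_program_correct[OF symmetric_lists_adjacency_lists[OF adj]] word_size_sufficient[of adj k w] A by blast
  show "answers_within w peel_program (encode_instance adj k) (25 * (card V + card E) + 20)
      (\<exists>col. equitable_tree_coloring V E k col)"
    unfolding answers_within_def Let_def col
    by (rule exI[of _ j]) (use run order_trans[OF j time] in simp)
qed

end
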